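(* Let $m\ge0$ and let $\mathbf{r}(t)=\sum_{k=0}^m(a_{k,1}+\mathrm{i}\,a_{k,2})L_k(t)$, with $a_{k,1},a_{k,2}\in\mathbb{R}$, be a nonzero planar polynomial curve. Let $\boldsymbol{a}=(a_{0,1},a_{0,2},a_{1,1},a_{1,2},\dots,a_{m,1},a_{m,2})^T\in\mathbb{R}^{2m+2}$, $\boldsymbol{e}_1=(1,0,\dots,0)^T$, $\boldsymbol{g}=\boldsymbol{a}+\mathrm{sign}(a_{0,1})\,\|\boldsymbol{a}\|_2\,\boldsymbol{e}_1$, and $Q=I-\frac{2}{\boldsymbol{g}^T\boldsymbol{g}}\,\boldsymbol{g}\boldsymbol{g}^T$, with columns $\boldsymbol{q}_1,\dots,\boldsymbol{q}_{2m+2}$. Then a curve $$\mathbf{r}_\perp(t)=\sum_{k=0}^m(b_{k,1}+\mathrm{i}\,b_{k,2})L_k(t),\qquad b_{k,1},b_{k,2}\in\mathbb{R},$$ is orthogonal to $\mathbf{r}$ if and only if its coefficient vector $\boldsymbol{b}=(b_{0,1},b_{0,2},b_{1,1},b_{1,2},\dots,b_{m,1},b_{m,2})^T$ has the form $\boldsymbol{b}=\sum_{k=2}^{2m+2}\xi_{k-1}\boldsymbol{q}_k$ for some $\xi_1,\dots,\xi_{2m+1}\in\mathbb{R}$. Moreover, the curves whose coefficient vectors are the columns of $Q$ are pairwise orthogonal.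
   Context: Planar curves are regarded as complex-valued polynomial functions of a real parameter $t\in[0,1]$. $\langle\mathbf{u},\mathbf{v}\rangle=\int_0^1\mathbf{u}(t)\overline{\mathbf{v}(t)}\,dt$, and $\mathbf{u},\mathbf{v}$ are called orthogonal if $\mathrm{Re}\,\langle\mathbf{u},\mathbf{v}\rangle=0$. $L_k$ are the real orthonormal Legendre polynomials on $[0,1]$: $L_k(t)=\sqrt{2k+1}\sum_{i=0}^k(-1)^{k+i}\binom{k}{i}\binom{k}{i}(1-t)^{k-i}t^i$, satisfying $\int_0^1L_jL_k\,dt=\delta_{jk}$. $\|\cdot\|_2$ is the Euclidean norm. Convention: $\mathrm{sign}(x)=1$ for $x\ge0$ and $\mathrm{sign}(x)=-1$ for $x<0$. *)

theory Defs
  imports "HOL-Analysis.Analysis" "Jordan_Normal_Form.Matrix"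
begin

unbundle no vec_syntax
unbundle no inner_syntax

definition curve_inner :: "(real \<Rightarrow> complex) \<Rightarrow> (real \<Rightarrow> complex) \<Rightarrow> complex" where
  "curve_inner u v = integral {0..1} (\<lambda>t. u t * cnj (v t))"

definition curve_orthogonal :: "(real \<Rightarrow> complex) \<Rightarrow> (real \<Rightarrow> complex) \<Rightarrow> bool" where
  "curve_orthogonal u v \<longleftrightarrow> Re (curve_inner u v) = 0"

definition legendre :: "nat \<Rightarrow> real \<Rightarrow> real" where
  "legendre k t = sqrt (2 * real k + 1) *
     (\<Sum>i=0..k. (-1) ^ (k + i) * real (k choose i) * real (k choose i) * (1 - t) ^ (k - i) * t ^ i)"

text \<open>A coefficient family \<open>c\<close> is indexed by the degree \<open>k \<in> {0..m}\<close> and the component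
  \<open>1\<close> (real part) or \<open>2\<close> (imaginary part); its values elsewhere are irrelevant.\<close>

definition legendre_curve :: "nat \<Rightarrow> (nat \<Rightarrow> nat \<Rightarrow> real) \<Rightarrow> real \<Rightarrow> complex" where
  "legendre_curve m c t = (\<Sum>k=0..m. Complex (c k 1) (c k 2) * complex_of_real (legendre k t))"

definition coeff_vec :: "nat \<Rightarrow> (nat \<Rightarrow> nat \<Rightarrow> real) \<Rightarrow> real Matrix.vec" where
  "coeff_vec m c = Matrix.vec (2 * m + 2) (\<lambda>i. c (i div 2) (i mod 2 + 1))"

text \<open>Unlike the library's \<^const>\<open>sgn\<close>, this takes the value \<open>1\<close> at \<open>0\<close>.\<close>

definition sign1 :: "real \<Rightarrow> real" where
  "sign1 x = (if x \<ge> 0 then 1 else -1)"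

definition vec_norm2 :: "real Matrix.vec \<Rightarrow> real" where
  "vec_norm2 v = L2_set (\<lambda>i. v $ i) {..<dim_vec v}"

definition householder_vec :: "real Matrix.vec \<Rightarrow> real Matrix.vec" where
  "householder_vec a = a + (sign1 (a $ 0) * vec_norm2 a) \<cdot>\<^sub>v unit_vec (dim_vec a) 0"

definition column_mat :: "real Matrix.vec \<Rightarrow> real Matrix.mat" where
  "column_mat v = mat_of_cols (dim_vec v) [v]"

definition householder_mat :: "real Matrix.vec \<Rightarrow> real Matrix.mat" where
  "householder_mat a =
     (let g = householder_vec a
      in 1\<^sub>m (dim_vec a) - (2 / (g \<bullet> g)) \<cdot>\<^sub>m (column_mat g * transpose_mat (column_mat g)))"

text \<open>Columns numbered from \<open>1\<close>.\<close>

definition householder_col :: "real Matrix.vec \<Rightarrow> nat \<Rightarrow> real Matrix.vec" where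
  "householder_col a k = col (householder_mat a) (k - 1)"

end

theory Submission
  imports Defs "HOL-Computational_Algebra.Polynomial"
begin

text \<open>
  Because the Legendre polynomials are orthonormal, passing to coefficient vectors is an isometry:
  the real part of the inner product of two curves is the dot product of their coefficient vectors
  (\<open>Re_curve_inner\<close>). The theorem is therefore a statement about vectors in Euclidean space.
  There, \<open>Q\<close> is a reflection, so it is symmetric and orthogonal, and the vector \<open>g\<close> is chosen
  exactly so that \<open>Q\<close> maps \<open>a\<close> to a multiple of the first unit vector; equivalently, the first
  column of \<open>Q\<close> is a nonzero multiple of \<open>a\<close> (\<open>householder_mat_first_col\<close>). The columns form an
  orthonormal basis, so the orthogonal complement of \<open>a\<close> is the span of the other columns
  (\<open>orthogonal_iff_span_householder_cols\<close>).

  Orthonormality of the Legendre polynomials is derived from their moments. In the Bernstein form,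
  integrating \<open>legendre k t * t ^ n\<close> termwise with Euler's Beta integral leaves the \<open>k\<close>-th finite
  difference of the degree-\<open>n\<close> polynomial \<open>i \<mapsto> (n + i choose n)\<close>, which is a multiple of
  \<open>n choose k\<close>. So \<open>legendre k\<close> is orthogonal to all lower powers, and its norm can be read off from
  its top moment and its leading coefficient.
\<close>

section \<open>Orthonormality of the Legendre polynomials\<close>

text \<open>The left-hand side is the \<open>k\<close>-th forward difference at \<open>N\<close> of \<open>x \<mapsto> (x choose n)\<close>; by
  Pascal's rule each difference lowers \<open>n\<close> by one.\<close>

lemma alternating_binomial_sum:
  "(\<Sum>i\<le>k. (-1) ^ (k + i) * real (k choose i) * real ((N + i) choose n)) =
     (if k \<le> n then real (N choose (n - k)) else 0)"
proof (induction k arbitrary: N n)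
  case 0
  show ?case by simp
next
  case (Suc k)
  define F where "F N n = (\<Sum>i\<le>k. (-1) ^ (k + i) * real (k choose i) * real ((N + i) choose n))" for N n
  have "(\<Sum>i\<le>Suc k. (-1) ^ (Suc k + i) * real (Suc k choose i) * real ((N + i) choose n)) =
     (-1) ^ Suc k * real (N choose n) +
     (\<Sum>i\<le>k. (-1) ^ (k + i) * real (Suc k choose Suc i) * real ((Suc N + i) choose n))"
    by (subst sum.atMost_Suc_shift) simp
  also have "(\<Sum>i\<le>k. (-1) ^ (k + i) * real (Suc k choose Suc i) * real ((Suc N + i) choose n)) =
     F (Suc N) n + (\<Sum>i\<le>k. (-1) ^ (k + i) * real (k choose Suc i) * real ((Suc N + i) choose n))"
    by (simp add: F_def sum.distrib[symmetric] algebra_simps)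
  also have "(-1) ^ Suc k * real (N choose n) + (F (Suc N) n +
      (\<Sum>i\<le>k. (-1) ^ (k + i) * real (k choose Suc i) * real ((Suc N + i) choose n))) =
      F (Suc N) n - (\<Sum>i\<le>Suc k. (-1) ^ (k + i) * real (k choose i) * real ((N + i) choose n))"
    by (subst sum.atMost_Suc_shift) (simp add: sum_negf)
  also have "\<dots> = F (Suc N) n - F N n"
    by (simp add: F_def)
  also have "\<dots> = (case n of 0 \<Rightarrow> 0 | Suc n' \<Rightarrow> F N n')"
    by (cases n) (simp_all add: F_def sum_subtractf[symmetric] algebra_simps)
  also have "\<dots> = (if Suc k \<le> n then real (N choose (n - Suc k)) else 0)"
    using Suc.IH[of N] by (cases n) (simp_all add: F_def)
  finally show ?case .
qed

text \<open>Induction on the exponent of \<open>1 - t\<close>, integrating by parts: the derivative of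
  \<open>t ^ (a + 1) * (1 - t) ^ (b + 1)\<close> has integral zero, since the boundary terms vanish.\<close>

lemma has_integral_Bernstein:
  "((\<lambda>t::real. t ^ a * (1 - t) ^ b) has_integral fact a * fact b / fact (a + b + 1)) {0..1}"
proof (induction b arbitrary: a)
  case 0
  have "((\<lambda>t::real. t ^ a) has_integral 1 ^ Suc a / real (Suc a) - 0 ^ Suc a / real (Suc a)) {0..1}"
    by (rule fundamental_theorem_of_calculus)
       (auto intro!: derivative_eq_intros simp: has_real_derivative_iff_has_vector_derivative[symmetric]
         simp del: power_Suc of_nat_Suc)
  then show ?case by simp
next
  case (Suc b)
  have "((\<lambda>t::real. real (Suc a) * (t ^ a * (1 - t) ^ Suc b) - real (Suc b) * (t ^ Suc a * (1 - t) ^ b))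
     has_integral 1 ^ Suc a * (1 - 1) ^ Suc b - 0 ^ Suc a * (1 - 0) ^ Suc b) {0..1}"
    by (rule fundamental_theorem_of_calculus)
       (auto intro!: derivative_eq_intros simp: has_real_derivative_iff_has_vector_derivative[symmetric]
         simp del: power_Suc of_nat_Suc)
  from has_integral_add[OF this has_integral_mult_right[OF Suc.IH[of "Suc a"], of "real (Suc b)"]]
  have "((\<lambda>t::real. real (Suc a) * (t ^ a * (1 - t) ^ Suc b)) has_integral
      real (Suc b) * (fact (Suc a) * fact b / fact (Suc a + b + 1))) {0..1}"
    by simp
  from has_integral_mult_right[OF this, of "1 / real (Suc a)"]
  have "((\<lambda>t::real. t ^ a * (1 - t) ^ Suc b) has_integral
      1 / real (Suc a) * (real (Suc b) * (fact (Suc a) * fact b / fact (Suc a + b + 1)))) {0..1}"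
    by (simp del: power_Suc of_nat_Suc fact_Suc)
  also have "1 / real (Suc a) * (real (Suc b) * (fact (Suc a) * fact b / fact (Suc a + b + 1)))
     = fact a * fact (Suc b) / fact (a + Suc b + 1)"
    by (simp del: of_nat_Suc fact_Suc add: fact_Suc[of a] fact_Suc[of b])
  finally show ?case .
qed

text \<open>The factorials from the Beta integrals cancel one of the two binomial coefficients and turn
  the other factor into \<open>n + i choose n\<close>, so that the sum becomes a finite difference.
  The moment vanishes for \<open>n < k\<close> because \<open>n choose k\<close> does.\<close>

lemma legendre_moment:
  "((\<lambda>t. legendre k t * t ^ n) has_integral
     sqrt (2 * real k + 1) * (fact k * fact n * real (n choose k) / fact (k + n + 1))) {0..1}"
proof -
  have "((\<lambda>t::real. sqrt (2 * real k + 1) * (\<Sum>i=0..k. (-1) ^ (k + i) * real (k choose i) * real (k choose i) *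
           (t ^ (i + n) * (1 - t) ^ (k - i)))) has_integral
         sqrt (2 * real k + 1) * (\<Sum>i=0..k. (-1) ^ (k + i) * real (k choose i) * real (k choose i) *
           (fact (i + n) * fact (k - i) / fact (i + n + (k - i) + 1)))) {0..1}"
    by (intro has_integral_mult_right has_integral_sum has_integral_Bernstein) auto
  also have "(\<lambda>t::real. sqrt (2 * real k + 1) * (\<Sum>i=0..k. (-1) ^ (k + i) * real (k choose i) * real (k choose i) *
           (t ^ (i + n) * (1 - t) ^ (k - i)))) = (\<lambda>t. legendre k t * t ^ n)"
    by (simp add: legendre_def fun_eq_iff sum_distrib_right sum_distrib_left power_add mult_ac)
  also have "(\<Sum>i=0..k. (-1) ^ (k + i) * real (k choose i) * real (k choose i) *
           (fact (i + n) * fact (k - i) / fact (i + n + (k - i) + 1))) =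
      (\<Sum>i\<le>k. (fact k * fact n / fact (k + n + 1)) *
         ((-1) ^ (k + i) * real (k choose i) * real ((n + i) choose n)))"
  proof (rule sum.cong)
    fix i assume "i \<in> {..k}"
    then have i: "i \<le> k" by simp
    have "real (k choose i) * fact (k - i) = fact k / fact i"
      using i by (simp add: binomial_fact)
    moreover have "fact (i + n) = fact i * fact n * real ((n + i) choose n)"
      by (simp add: binomial_fact add.commute)
    moreover have "i + n + (k - i) + 1 = k + n + 1" using i by simp
    ultimately show "(-1) ^ (k + i) * real (k choose i) * real (k choose i) *
           (fact (i + n) * fact (k - i) / fact (i + n + (k - i) + 1)) =
         (fact k * fact n / fact (k + n + 1)) *
         ((-1) ^ (k + i) * real (k choose i) * real ((n + i) choose n))"
      using i by (simp add: binomial_fact field_simps del: fact_Suc)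
  qed auto
  also have "\<dots> = fact k * fact n / fact (k + n + 1) * (if k \<le> n then real (n choose (n - k)) else 0)"
    by (simp only: sum_distrib_left[symmetric] alternating_binomial_sum)
  also have "\<dots> = fact k * fact n * real (n choose k) / fact (k + n + 1)"
    by (auto simp: binomial_symmetric[symmetric])
  finally show ?thesis .
qed

text \<open>Up to the normalising square root, each Bernstein term contributes \<open>(k choose i)\<^sup>2\<close> to the leading coefficient, the two signs
  cancelling, and these squares add up to the central binomial coefficient.\<close>

lemma legendre_poly_expansion:
  obtains c :: "nat \<Rightarrow> real" where
    "\<And>t. legendre k t = (\<Sum>n\<le>k. c n * t ^ n)"
    "c k = sqrt (2 * real k + 1) * real (2 * k choose k)"
proof
  define q :: "nat \<Rightarrow> real poly" where "q i = [:1, -1:] ^ (k - i) * Polynomial.monom 1 i" for i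
  define p where "p = Polynomial.smult (sqrt (2 * real k + 1))
     (\<Sum>i\<le>k. Polynomial.smult ((-1) ^ (k + i) * real (k choose i) * real (k choose i)) (q i))"
  have deg: "Polynomial.degree (q i) = k" and lead: "Polynomial.coeff (q i) k = (-1) ^ (k - i)" if "i \<le> k" for i
  proof -
    show d: "Polynomial.degree (q i) = k"
      using that by (simp add: q_def degree_mult_eq degree_power_eq degree_monom_eq)
    have "Polynomial.coeff (q i) (Polynomial.degree (q i)) = (-1) ^ (k - i)"
      unfolding q_def lead_coeff_mult by (simp add: lead_coeff_power degree_monom_eq)
    then show "Polynomial.coeff (q i) k = (-1) ^ (k - i)" by (simp add: d)
  qed
  have "Polynomial.degree p \<le> k"
    unfolding p_def
    by (intro order.trans[OF degree_smult_le] degree_sum_le) (auto simp: deg)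
  then have "poly p t = (\<Sum>n\<le>k. Polynomial.coeff p n * t ^ n)" for t
    by (auto simp: poly_altdef intro!: sum.mono_neutral_left intro: le_degree)
  moreover have "poly p t = legendre k t" for t
    by (simp add: p_def q_def legendre_def poly_sum poly_monom atMost_atLeast0 mult_ac)
  ultimately show "legendre k t = (\<Sum>n\<le>k. Polynomial.coeff p n * t ^ n)" for t by simp
  have "Polynomial.coeff p k = sqrt (2 * real k + 1) *
     (\<Sum>i\<le>k. (-1) ^ (k + i) * real (k choose i) * real (k choose i) * (-1) ^ (k - i))"
    by (simp add: p_def coeff_sum lead)
  also have "(\<Sum>i\<le>k. (-1) ^ (k + i) * real (k choose i) * real (k choose i) * (-1) ^ (k - i)) =
      (\<Sum>i\<le>k. real ((k choose i)\<^sup>2))"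
  proof (rule sum.cong)
    fix i assume "i \<in> {..k}"
    then have "(-1::real) ^ (k + i) * (-1) ^ (k - i) = 1"
      by (simp add: power_add[symmetric])
    then show "(-1) ^ (k + i) * real (k choose i) * real (k choose i) * (-1) ^ (k - i) =
        real ((k choose i)\<^sup>2)"
      by (simp add: power2_eq_square)
  qed simp
  also have "\<dots> = real (2 * k choose k)"
    by (simp only: of_nat_sum[symmetric] choose_square_sum)
  finally show "Polynomial.coeff p k = sqrt (2 * real k + 1) * real (2 * k choose k)" .
qed

text \<open>Expand the factor of lower degree in powers of \<open>t\<close>: among the moments of the other factor at
  most the top one survives, and only if the degrees agree.\<close>

lemma legendre_orthonormal:
  "((\<lambda>t. legendre j t * legendre k t) has_integral (if j = k then 1 else 0)) {0..1}"
proof -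
  have le: "((\<lambda>t. legendre j t * legendre k t) has_integral (if j = k then 1 else 0)) {0..1}"
    if "j \<le> k" for j k
  proof -
    obtain c where c: "\<And>t. legendre j t = (\<Sum>n\<le>j. c n * t ^ n)"
      and lead: "c j = sqrt (2 * real j + 1) * real (2 * j choose j)"
      using legendre_poly_expansion[of j] by blast
    define M where "M n = sqrt (2 * real k + 1) * (fact k * fact n * real (n choose k) / fact (k + n + 1))" for n
    have "((\<lambda>t. \<Sum>n\<le>j. c n * (legendre k t * t ^ n)) has_integral (\<Sum>n\<le>j. c n * M n)) {0..1}"
      unfolding M_def by (intro has_integral_sum has_integral_mult_right legendre_moment) auto
    also have "(\<lambda>t. \<Sum>n\<le>j. c n * (legendre k t * t ^ n)) = (\<lambda>t. legendre j t * legendre k t)"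
      by (simp add: c sum_distrib_right sum_distrib_left mult_ac)
    also have "(\<Sum>n\<le>j. c n * M n) = (if j = k then c j * M j else 0)"
    proof -
      have "M n = 0" if "n < k" for n
        using that by (simp add: M_def)
      then have "(\<Sum>n\<le>j. c n * M n) = (\<Sum>n\<le>j. if n = k then c n * M n else 0)"
        using that by (intro sum.cong) auto
      then show ?thesis using that by auto
    qed
    also have "\<dots> = (if j = k then 1 else 0)"
    proof -
      have "c j * M j = 1" if "j = k"
      proof -
        have "real (2 * k choose k) = fact (2 * k) / (fact k * fact k)"
          by (subst binomial_fact) (auto simp: mult_2)
        moreover have "fact (k + k + 1) = (2 * real k + 1) * fact (2 * k)"
          by (simp add: mult_2[symmetric] del: mult_2_right)
        moreover have "s * (D / (F * F)) * (s * (F * F * 1 / (E * D))) = s * s / E"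
          if "F \<noteq> 0" "D \<noteq> 0" for s D E F :: real
          using that by simp
        ultimately have "c j * M j = sqrt (2 * real k + 1) * sqrt (2 * real k + 1) / (2 * real k + 1)"
          unfolding M_def \<open>j = k\<close> lead[unfolded \<open>j = k\<close>] binomial_n_n of_nat_1 by (simp only: fact_nonzero not_False_eq_True)
        then show ?thesis by simp
      qed
      then show ?thesis by simp
    qed
    finally show ?thesis .
  qed
  show ?thesis
  proof (cases "j \<le> k")
    case True
    then show ?thesis by (rule le)
  next
    case False
    then show ?thesis using le[of k j] by (simp add: mult.commute eq_commute)
  qed
qed

section \<open>Curves and their coefficient vectors\<close>

lemma sum_interleave:
  fixes f :: "nat \<Rightarrow> real"
  shows "(\<Sum>i<2 * m + 2. f i) = (\<Sum>k=0..m. f (2 * k) + f (2 * k + 1))"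
  by (induction m) (simp_all add: eval_nat_numeral)

lemma Re_curve_inner:
  "Re (curve_inner (legendre_curve m c) (legendre_curve m d)) = coeff_vec m c \<bullet> coeff_vec m d"
proof -
  define C where "C k = Complex (c k 1) (c k 2)" for k
  define D where "D k = Complex (d k 1) (d k 2)" for k
  have "((\<lambda>t. \<Sum>j=0..m. \<Sum>k=0..m. C j * cnj (D k) * complex_of_real (legendre j t * legendre k t))
     has_integral (\<Sum>j=0..m. \<Sum>k=0..m. C j * cnj (D k) * complex_of_real (if j = k then 1 else 0))) {0..1}"
    by (intro has_integral_sum has_integral_mult_right has_integral_of_real legendre_orthonormal) auto
  also have "(\<lambda>t. \<Sum>j=0..m. \<Sum>k=0..m. C j * cnj (D k) * complex_of_real (legendre j t * legendre k t))
      = (\<lambda>t. legendre_curve m c t * cnj (legendre_curve m d t))"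
    by (simp add: legendre_curve_def C_def D_def fun_eq_iff sum_product mult_ac)
  also have "(\<Sum>j=0..m. \<Sum>k=0..m. C j * cnj (D k) * complex_of_real (if j = k then 1 else 0))
      = (\<Sum>j=0..m. C j * cnj (D j))"
    by (intro sum.cong refl) (simp add: if_distrib[of complex_of_real] if_distrib[of "(*) _"] cong: if_cong)
  finally have "curve_inner (legendre_curve m c) (legendre_curve m d) = (\<Sum>j=0..m. C j * cnj (D j))"
    unfolding curve_inner_def by (rule integral_unique)
  then have "Re (curve_inner (legendre_curve m c) (legendre_curve m d)) =
      (\<Sum>j=0..m. c j 1 * d j 1 + c j 2 * d j 2)"
    by (simp add: C_def D_def)
  also have "\<dots> = (\<Sum>i<2 * m + 2. c (i div 2) (i mod 2 + 1) * d (i div 2) (i mod 2 + 1))"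
    by (subst sum_interleave) (simp add: numeral_2_eq_2[symmetric])
  also have "\<dots> = coeff_vec m c \<bullet> coeff_vec m d"
    by (simp add: scalar_prod_def coeff_vec_def atLeast0LessThan)
  finally show ?thesis .
qed

lemma coeff_vec_nonzero:
  assumes "legendre_curve m a t \<noteq> 0"
  shows "coeff_vec m a \<noteq> 0\<^sub>v (2 * m + 2)"
proof
  assume z: "coeff_vec m a = 0\<^sub>v (2 * m + 2)"
  have *: "a (i div 2) (i mod 2 + 1) = 0" if "i < 2 * m + 2" for i
    using arg_cong[OF z, of "\<lambda>v. v $ i"] that by (simp add: coeff_vec_def)
  have "Complex (a k 1) (a k 2) = 0" if "k \<le> m" for k
    using *[of "2 * k"] *[of "2 * k + 1"] that by (simp add: complex_eq_iff numeral_2_eq_2[symmetric])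
  then have "legendre_curve m a t = 0" by (simp add: legendre_curve_def)
  with assms show False by contradiction
qed

section \<open>The Householder reflection\<close>

lemma vec_norm2_square: "(vec_norm2 v)\<^sup>2 = v \<bullet> v"
  by (simp add: vec_norm2_def L2_set_def sum_nonneg scalar_prod_def power2_eq_square atLeast0LessThan)

lemma householder_mat_index:
  assumes "i < dim_vec a" "j < dim_vec a"
  shows "householder_mat a $$ (i, j) = (if i = j then 1 else 0) -
    2 / (householder_vec a \<bullet> householder_vec a) * (householder_vec a $ i * householder_vec a $ j)"
proof -
  let ?g = "householder_vec a"
  have dim: "dim_vec ?g = dim_vec a" by (simp add: householder_vec_def)
  have "(column_mat ?g * transpose_mat (column_mat ?g)) $$ (i, j) = ?g $ i * ?g $ j"
    using assms by (simp add: column_mat_def mat_of_cols_def dim scalar_prod_def)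
  then show ?thesis
    using assms by (simp add: householder_mat_def Let_def column_mat_def dim)
qed

lemma householder_mat_carrier [simp]:
  "householder_mat a \<in> carrier_mat (dim_vec a) (dim_vec a)"
  by (rule carrier_matI) (simp_all add: householder_mat_def Let_def column_mat_def householder_vec_def)

lemma householder_mat_dim [simp]:
  "dim_row (householder_mat a) = dim_vec a" "dim_col (householder_mat a) = dim_vec a"
  by (rule carrier_matD[OF householder_mat_carrier])+

lemma householder_mat_symmetric:
  "transpose_mat (householder_mat a) = householder_mat a"
proof (rule eq_matI)
  fix i j assume "i < dim_row (householder_mat a)" "j < dim_col (householder_mat a)"
  then have ij: "i < dim_vec a" "j < dim_vec a" by simp_all
  have "householder_mat a $$ (j, i) = householder_mat a $$ (i, j)"
    unfolding householder_mat_index[OF ij] householder_mat_index[OF ij(2) ij(1)]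
    by (cases "i = j") (simp_all add: mult.commute)
  then show "transpose_mat (householder_mat a) $$ (i, j) = householder_mat a $$ (i, j)"
    using ij by simp
qed simp_all

text \<open>The sign in the definition of the reflection vector makes the cross term nonnegative, which
  gives the absolute value here; in particular the reflection vector of a nonzero vector is
  nonzero, so the division in the reflection is harmless.\<close>

lemma householder_vec_self_scalar:
  assumes "0 < dim_vec a"
  shows "householder_vec a \<bullet> householder_vec a = 2 * vec_norm2 a * (vec_norm2 a + \<bar>a $ 0\<bar>)"
proof -
  define s where "s = sign1 (a $ 0) * vec_norm2 a"
  have "householder_vec a \<bullet> householder_vec a =
      (\<Sum>i<dim_vec a. a $ i * a $ i + (if i = 0 then 2 * s * a $ 0 + s * s else 0))"
    unfolding scalar_prod_def householder_vec_def s_def[symmetric]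
    by (rule sum.cong) (auto simp: algebra_simps)
  also have "\<dots> = (vec_norm2 a)\<^sup>2 + 2 * s * a $ 0 + s * s"
    using assms by (simp add: vec_norm2_square sum.distrib scalar_prod_def atLeast0LessThan)
  also have "\<dots> = 2 * vec_norm2 a * (vec_norm2 a + \<bar>a $ 0\<bar>)"
    by (simp add: s_def sign1_def power2_eq_square algebra_simps)
  finally show ?thesis .
qed

lemma vec_norm2_pos:
  assumes "v \<in> carrier_vec n" "v \<noteq> 0\<^sub>v n"
  shows "0 < vec_norm2 v"
proof -
  obtain i where "i < n" "v $ i \<noteq> 0"
    using assms by (metis eq_vecI carrier_vecD index_zero_vec)
  then have "vec_norm2 v \<noteq> 0"
    using assms by (auto simp: vec_norm2_def L2_set_eq_0_iff)
  then show ?thesis by (simp add: vec_norm2_def order.not_eq_order_implies_strict)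
qed

text \<open>With \<open>\<sigma>\<close> the sign of the first entry, \<open>2 * g\<^sub>0 / (g \<bullet> g)\<close> collapses to \<open>\<sigma> / \<parallel>a\<parallel>\<close>,
  since both \<open>g\<^sub>0\<close> and \<open>g \<bullet> g\<close> contain the factor \<open>\<parallel>a\<parallel> + \<bar>a\<^sub>0\<bar>\<close>. The summand
  \<open>\<sigma> * \<parallel>a\<parallel>\<close> added to the first entry of \<open>a\<close> then cancels the first unit vector.\<close>

lemma householder_mat_first_col:
  assumes "0 < dim_vec a" "0 < vec_norm2 a"
  shows "col (householder_mat a) 0 = (- sign1 (a $ 0) / vec_norm2 a) \<cdot>\<^sub>v a"
proof (rule eq_vecI)
  fix i assume "i < dim_vec ((- sign1 (a $ 0) / vec_norm2 a) \<cdot>\<^sub>v a)"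
  then have i: "i < dim_vec a" by simp
  define \<sigma> where "\<sigma> = sign1 (a $ 0)"
  have g0: "householder_vec a $ 0 = \<sigma> * (vec_norm2 a + \<bar>a $ 0\<bar>)"
    using assms by (simp add: householder_vec_def \<sigma>_def sign1_def)
  have "vec_norm2 a + \<bar>a $ 0\<bar> > 0" using assms by simp
  moreover have cancel: "2 / (2 * n * x) * (\<sigma> * x) = \<sigma> / n" if "n > 0" "x > 0" for n x :: real
    using that by simp
  ultimately have f: "2 / (householder_vec a \<bullet> householder_vec a) * householder_vec a $ 0 = \<sigma> / vec_norm2 a"
    unfolding g0 householder_vec_self_scalar[OF assms(1)] using assms(2) cancel by simp
  have gi: "householder_vec a $ i = a $ i + (if i = 0 then \<sigma> * vec_norm2 a else 0)"
    using i assms by (simp add: householder_vec_def \<sigma>_def)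
  have "\<sigma> * \<sigma> = 1" by (simp add: \<sigma>_def sign1_def)
  have "householder_mat a $$ (i, 0) = (if i = 0 then 1 else 0) - \<sigma> / vec_norm2 a * householder_vec a $ i"
    using i assms by (simp add: householder_mat_index f[symmetric])
  also have "\<dots> = - \<sigma> / vec_norm2 a * a $ i"
    using assms(2) \<open>\<sigma> * \<sigma> = 1\<close> by (simp add: gi field_simps)
  finally show "col (householder_mat a) 0 $ i = ((- sign1 (a $ 0) / vec_norm2 a) \<cdot>\<^sub>v a) $ i"
    using i assms householder_mat_carrier[of a] by (simp add: \<sigma>_def)
qed (use householder_mat_carrier[of a] in simp)

lemma householder_mat_involution:
  assumes "0 < dim_vec a" "0 < vec_norm2 a"
  shows "householder_mat a * householder_mat a = 1\<^sub>m (dim_vec a)"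
proof (rule eq_matI)
  let ?n = "dim_vec a" and ?g = "householder_vec a" and ?Q = "householder_mat a"
  define \<gamma> where "\<gamma> = ?g \<bullet> ?g"
  have dg: "dim_vec ?g = ?n" by (simp add: householder_vec_def)
  have "\<gamma> \<noteq> 0" using assms by (simp add: \<gamma>_def householder_vec_self_scalar)
  have \<gamma>: "(\<Sum>l<?n. ?g $ l * ?g $ l) = \<gamma>"
    by (simp add: \<gamma>_def scalar_prod_def dg atLeast0LessThan)
  fix i j assume "i < dim_row (1\<^sub>m ?n :: real mat)" "j < dim_col (1\<^sub>m ?n :: real mat)"
  then have ij: "i < ?n" "j < ?n" by auto
  have "(?Q * ?Q) $$ (i, j) = (\<Sum>l<?n. ?Q $$ (i, l) * ?Q $$ (l, j))"
    using ij householder_mat_carrier[of a] by (simp add: scalar_prod_def atLeast0LessThan)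
  also have "\<dots> = (\<Sum>l<?n. (if l = i then if i = j then 1 else 0 else 0)
      - (if l = i then 2 / \<gamma> * (?g $ i * ?g $ j) else 0)
      - (if l = j then 2 / \<gamma> * (?g $ i * ?g $ j) else 0)
      + (2 / \<gamma>)\<^sup>2 * (?g $ i * ?g $ j) * (?g $ l * ?g $ l))"
    using ij by (intro sum.cong refl)
      (auto simp: householder_mat_index \<gamma>_def[symmetric] algebra_simps power2_eq_square)
  also have "\<dots> = (if i = j then 1 else 0) - 2 * (2 / \<gamma> * (?g $ i * ?g $ j))
      + (2 / \<gamma>)\<^sup>2 * (?g $ i * ?g $ j) * \<gamma>"
    using ij by (simp add: sum.distrib sum_subtractf sum_distrib_left[symmetric] \<gamma>)
  also have "\<dots> = (1\<^sub>m ?n :: real mat) $$ (i, j)"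
    using ij \<open>\<gamma> \<noteq> 0\<close> by (simp add: power2_eq_square)
  finally show "(?Q * ?Q) $$ (i, j) = (1\<^sub>m ?n :: real mat) $$ (i, j)" .
qed (use householder_mat_carrier[of a] in auto)

lemma householder_cols_orthonormal:
  assumes "0 < dim_vec a" "0 < vec_norm2 a" "i < dim_vec a" "j < dim_vec a"
  shows "col (householder_mat a) i \<bullet> col (householder_mat a) j = (if i = j then 1 else 0)"
proof -
  have "col (householder_mat a) i \<bullet> col (householder_mat a) j
      = (transpose_mat (householder_mat a) * householder_mat a) $$ (i, j)"
    using assms householder_mat_carrier[of a] by simp
  then show ?thesis
    using assms by (simp add: householder_mat_symmetric householder_mat_involution)
qed

text \<open>The matrix is its own inverse, so \<open>b\<close> is recovered by applying it twice; by symmetry the inner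
  application produces the dot products with the columns.\<close>

lemma householder_cols_expansion:
  assumes "0 < dim_vec a" "0 < vec_norm2 a" "b \<in> carrier_vec (dim_vec a)" "i < dim_vec a"
  shows "b $ i = (\<Sum>l<dim_vec a. (col (householder_mat a) l \<bullet> b) * col (householder_mat a) l $ i)"
proof -
  let ?Q = "householder_mat a"
  have r: "row ?Q l = col ?Q l" if "l < dim_vec a" for l
    using that householder_mat_carrier[of a]
    by (metis row_transpose householder_mat_symmetric carrier_matD(2))
  have "b = ?Q *\<^sub>v (?Q *\<^sub>v b)"
    unfolding assoc_mult_mat_vec[OF householder_mat_carrier householder_mat_carrier assms(3), symmetric]
    using assms by (simp add: householder_mat_involution)
  then have "b $ i = (?Q *\<^sub>v (?Q *\<^sub>v b)) $ i" by simp
  also have "\<dots> = (\<Sum>l<dim_vec a. ?Q $$ (i, l) * (col ?Q l \<bullet> b))"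
    using assms unfolding index_mult_mat_vec[of i ?Q, unfolded householder_mat_dim, OF assms(4)]
      scalar_prod_def[of "row ?Q i"]
    by (intro sum.cong) (auto simp: r[symmetric])
  finally show ?thesis
    using assms householder_mat_carrier[of a] by (simp add: mult.commute)
qed

lemma finsum_householder_cols_index:
  assumes "dim_vec a = n" "i < dim_vec a"
  shows "finsum_vec TYPE(real) n (\<lambda>k. \<xi> (k - 1) \<cdot>\<^sub>v householder_col a k) {2..n} $ i
     = (\<Sum>l\<in>{1..<n}. \<xi> l * col (householder_mat a) l $ i)"
proof -
  have "finsum_vec TYPE(real) n (\<lambda>k. \<xi> (k - 1) \<cdot>\<^sub>v householder_col a k) {2..n} $ i
     = (\<Sum>k\<in>{2..n}. (\<xi> (k - 1) \<cdot>\<^sub>v householder_col a k) $ i)"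
    using assms
    by (intro index_finsum_vec) (auto simp: householder_col_def intro!: carrier_vecI)
  also have "\<dots> = (\<Sum>l\<in>{1..<n}. (\<xi> l \<cdot>\<^sub>v col (householder_mat a) l) $ i)"
    by (rule sum.reindex_bij_witness[of _ Suc "\<lambda>k. k - 1"]) (auto simp: householder_col_def)
  also have "\<dots> = (\<Sum>l\<in>{1..<n}. \<xi> l * col (householder_mat a) l $ i)"
    using assms householder_mat_carrier[of a] by simp
  finally show ?thesis .
qed

text \<open>Orthogonality to \<open>a\<close> is orthogonality to the first column, and this means precisely that the
  first coefficient in the expansion of \<open>b\<close> along the columns vanishes.\<close>

lemma orthogonal_iff_span_householder_cols:
  assumes dim: "dim_vec a = n" and n: "0 < n" and pos: "0 < vec_norm2 a"
    and b: "b \<in> carrier_vec n"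
  shows "b \<bullet> a = 0 \<longleftrightarrow> (\<exists>\<xi> :: nat \<Rightarrow> real. b =
    finsum_vec TYPE(real) n (\<lambda>k. \<xi> (k - 1) \<cdot>\<^sub>v householder_col a k) {2..n})"
    (is "_ \<longleftrightarrow> (\<exists>\<xi>. b = ?S \<xi>)")
proof -
  let ?q = "col (householder_mat a)"
  let ?I = "{1..<n}"
  have n: "0 < dim_vec a" using dim n by simp
  have q: "?q l \<in> carrier_vec n" for l
    using dim by (intro carrier_vecI) simp
  have S: "?S \<xi> \<in> carrier_vec n" for \<xi>
    by (rule finsum_vec_closed) (use q in \<open>auto simp: householder_col_def\<close>)
  have dimS: "dim_vec (?S (\<lambda>l. ?q l \<bullet> b)) = n"
    by (rule carrier_vecD[OF S])
  have "?q 0 \<bullet> b = - sign1 (a $ 0) / vec_norm2 a * (b \<bullet> a)"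
    using householder_mat_first_col[OF n pos] b comm_scalar_prod[OF b carrier_vecI[OF dim]] dim
    by simp
  then have first: "b \<bullet> a = 0 \<longleftrightarrow> ?q 0 \<bullet> b = 0"
    using pos by (auto simp: sign1_def split: if_splits)
  have zero: "?q 0 \<bullet> b = 0" if "b = ?S \<xi>" for \<xi>
  proof -
    have coord: "b $ i = (\<Sum>l\<in>?I. \<xi> l * ?q l $ i)" if "i < n" for i
      using finsum_householder_cols_index[OF dim, of i \<xi>] that dim \<open>b = ?S \<xi>\<close> by simp
    have "?q 0 \<bullet> b = (\<Sum>i<n. ?q 0 $ i * (\<Sum>l\<in>?I. \<xi> l * ?q l $ i))"
      using b unfolding scalar_prod_def carrier_vecD[OF b] atLeast0LessThan
      by (intro sum.cong) (auto simp only: lessThan_iff coord)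
    also have "\<dots> = (\<Sum>i<n. \<Sum>l\<in>?I. \<xi> l * (?q 0 $ i * ?q l $ i))"
      by (simp add: sum_distrib_left mult_ac)
    also have "\<dots> = (\<Sum>l\<in>?I. \<xi> l * (\<Sum>i<n. ?q 0 $ i * ?q l $ i))"
      by (subst sum.swap) (simp add: sum_distrib_left)
    also have "\<dots> = (\<Sum>l\<in>?I. \<xi> l * (?q 0 \<bullet> ?q l))"
      unfolding scalar_prod_def carrier_vecD[OF q] by (simp only: atLeast0LessThan)
    also have "\<dots> = 0"
      using dim by (intro sum.neutral ballI) (simp add: householder_cols_orthonormal[OF n pos])
    finally show ?thesis .
  qed
  have span: "b = ?S (\<lambda>l. ?q l \<bullet> b)" if "?q 0 \<bullet> b = 0"
  proof (rule eq_vecI)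
    fix i assume "i < dim_vec (?S (\<lambda>l. ?q l \<bullet> b))"
    then have i: "i < dim_vec a" by (simp only: dimS dim)
    have "b $ i = (\<Sum>l<dim_vec a. (?q l \<bullet> b) * ?q l $ i)"
      using householder_cols_expansion[OF n pos _ i] b dim by simp
    also have "\<dots> = (\<Sum>l\<in>?I. (?q l \<bullet> b) * ?q l $ i)"
    proof -
      have "{..<dim_vec a} = insert 0 ?I" using n dim by auto
      then show ?thesis using that by (simp only:) simp
    qed
    finally show "b $ i = ?S (\<lambda>l. ?q l \<bullet> b) $ i"
      by (simp only: finsum_householder_cols_index[OF dim i, of "\<lambda>l. ?q l \<bullet> b"])
  qed (simp only: dimS carrier_vecD[OF b])
  show ?thesis
    unfolding first
  proof
    assume "?q 0 \<bullet> b = 0"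
    from span[OF this] show "\<exists>\<xi>. b = ?S \<xi>" by (rule exI[where P = "\<lambda>\<xi>. b = ?S \<xi>"])
  next
    assume "\<exists>\<xi>. b = ?S \<xi>"
    then obtain \<xi> where "b = ?S \<xi>" ..
    then show "?q 0 \<bullet> b = 0" by (rule zero)
  qed
qed

theorem mainTheorem5:
  fixes m :: nat and a :: "nat \<Rightarrow> nat \<Rightarrow> real"
  assumes nonzero: "\<exists>t\<in>{0..1}. legendre_curve m a t \<noteq> 0"
  shows "(\<forall>b :: nat \<Rightarrow> nat \<Rightarrow> real.
            curve_orthogonal (legendre_curve m b) (legendre_curve m a) \<longleftrightarrow>
            (\<exists>\<xi> :: nat \<Rightarrow> real. coeff_vec m b =
               finsum_vec TYPE(real) (2 * m + 2)
                 (\<lambda>k. \<xi> (k - 1) \<cdot>\<^sub>v householder_col (coeff_vec m a) k) {2..2 * m + 2})) \<and>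
         (\<forall>j\<in>{1..2 * m + 2}. \<forall>k\<in>{1..2 * m + 2}. j \<noteq> k \<longrightarrow>
            (\<forall>c d :: nat \<Rightarrow> nat \<Rightarrow> real.
               coeff_vec m c = householder_col (coeff_vec m a) j \<longrightarrow>
               coeff_vec m d = householder_col (coeff_vec m a) k \<longrightarrow>
               curve_orthogonal (legendre_curve m c) (legendre_curve m d)))"
proof -
  have carrier: "coeff_vec m c \<in> carrier_vec (2 * m + 2)" for c
    by (simp add: coeff_vec_def)
  have dim: "dim_vec (coeff_vec m a) = 2 * m + 2"
    by (simp add: coeff_vec_def)
  have pos: "0 < vec_norm2 (coeff_vec m a)"
    using nonzero coeff_vec_nonzero vec_norm2_pos[OF carrier] by blast
  have "curve_orthogonal (legendre_curve m c) (legendre_curve m d)"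
    if "j \<in> {1..2 * m + 2}" "k \<in> {1..2 * m + 2}" "j \<noteq> k"
      "coeff_vec m c = householder_col (coeff_vec m a) j"
      "coeff_vec m d = householder_col (coeff_vec m a) k" for j k c d
    using that(1-3) unfolding curve_orthogonal_def Re_curve_inner that(4,5) householder_col_def
    by (subst householder_cols_orthonormal[OF _ pos]) (auto simp: dim)
  moreover have "curve_orthogonal (legendre_curve m b) (legendre_curve m a) \<longleftrightarrow>
      (\<exists>\<xi> :: nat \<Rightarrow> real. coeff_vec m b =
         finsum_vec TYPE(real) (2 * m + 2)
           (\<lambda>k. \<xi> (k - 1) \<cdot>\<^sub>v householder_col (coeff_vec m a) k) {2..2 * m + 2})" for b
    unfolding curve_orthogonal_def Re_curve_inner
    by (rule orthogonal_iff_span_householder_cols[OF dim _ pos carrier]) simp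
  ultimately show ?thesis by blast
qed

end
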